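(* Let $b,c$ be positive integers and let $(a_1,a_2)\in\Phi^{im}_+$. Write the greedy element $x[a_1,a_2]\in\mathcal{A}(b,c)$ as $x[a_1,a_2]=x_1^{-a_1}x_2^{-a_2}\sum_{p,q\ge 0}e(p,q)x_1^{bp}x_2^{cq}$. Then the family of pointed coefficients $(e(p,q))_{p,q\in\mathbb{Z}_{\ge0}}$ is the unique family of integers with $e(0,0)=1$ satisfying the following two axioms: (Support) $e(p,q)=0$ for all $(p,q)\notin R_{\text{greedy}}$; (Divisibility) for all integers $p,q\ge 0$: - if $a_2>cq$, then $(1+t)^{a_2-cq}$ divides $\sum_{i\ge0}e(i,q)t^i$ in $\mathbb{Z}[t]$; - if $a_1>bp$, then $(1+t)^{a_1-bp}$ divides $\sum_{i\ge0}e(p,i)t^i$ in $\mathbb{Z}[t]$.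
   Context: The commutative rank 2 cluster algebra $\mathcal{A}(b,c)$ is the $\mathbb{Z}$-subalgebra of $\mathbb{Q}(x_1,x_2)$ generated by the cluster variables $\{x_m\}_{m\in\mathbb{Z}}$, defined recursively from $x_1,x_2$ by $x_{m+1}x_{m-1}=x_m^b+1$ if $m$ is odd and $x_{m+1}x_{m-1}=x_m^c+1$ if $m$ is even. An element $x\in\mathcal{A}(b,c)$ is pointed at $(a_1,a_2)\in\mathbb{Z}^2$ if $x=x_1^{-a_1}x_2^{-a_2}\sum_{p,q\ge0}e(p,q)x_1^{bp}x_2^{cq}$ with $e(0,0)=1$ and all $e(p,q)\in\mathbb{Z}$ (a finite sum); the $e(p,q)$ are its pointed coefficients. Greedy elements: it is known (Lee–Li–Zelevinsky) that for each $(a_1,a_2)\in\mathbb{Z}^2$ there is a unique element of $\mathcal{A}(b,c)$ pointed at $(a_1,a_2)$ whose coefficients satisfy $e(0,0)=1$ and, for $(p,q)\in\mathbb{Z}_{\ge0}^2\setminus\{(0,0)\}$, $$e(p,q)=\sum_{k=1}^p(-1)^{k-1}e(p-k,q)\binom{[a_2-cq]_++k-1}{k}\quad\text{if } ca_1q\le ba_2p,$$ $$e(p,q)=\sum_{\ell=1}^q(-1)^{\ell-1}e(p,q-\ell)\binom{[a_1-bp]_++\ell-1}{\ell}\quad\text{if } ca_1q\ge ba_2p,$$ where $[a]_+=\max(a,0)$. This element is the greedy element $x[a_1,a_2]$. The set of positive imaginary roots is $\Phi^{im}_+=\{(a_1,a_2)\in\mathbb{Z}_{>0}^2: ca_1^2-bca_1a_2+ba_2^2\le0\}$.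 For $(a_1,a_2)\in\Phi^{im}_+$, $$R_{\text{greedy}}=\Big\{(p,q)\in\mathbb{R}_{\ge0}^2 : q+\Big(b-\frac{ba_2}{ca_1}\Big)p<a_1\ \text{ or }\ p+\Big(c-\frac{ca_1}{ba_2}\Big)q<a_2\Big\}\cup\{(0,a_1),(a_2,0)\}.$$ *)

theory Defs
  imports Complex_Main "HOL-Computational_Algebra.Polynomial_Factorial"
begin

(* The field Q(x1, x2), as the fraction field of (Q[x1])[x2]. *)
type_synonym ratfun2 = "rat poly poly fract"

definition X1 :: ratfun2 where
  "X1 = to_fract [:[:0, 1:]:]"

definition X2 :: ratfun2 where
  "X2 = to_fract [:0, 1:]"

definition exch_exp :: "nat \<Rightarrow> nat \<Rightarrow> int \<Rightarrow> nat" where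
  "exch_exp b c m = (if odd m then b else c)"

(* The exchange relations x_(m+1) x_(m-1) = x_m^b + 1 (m odd), x_m^c + 1 (m even), solved for
   the new variable; upwards for m > 2 and downwards for m < 1.  All divisors are nonzero, and the
   relations themselves are the lemma cluster_var_exchange below. *)
function cluster_var :: "nat \<Rightarrow> nat \<Rightarrow> int \<Rightarrow> ratfun2" where
  "cluster_var b c m =
     (if m = 1 then X1
      else if m = 2 then X2
      else if m > 2 then
        (cluster_var b c (m - 1) ^ exch_exp b c (m - 1) + 1) / cluster_var b c (m - 2)
      else
        (cluster_var b c (m + 1) ^ exch_exp b c (m + 1) + 1) / cluster_var b c (m + 2))"
  by pat_completeness auto
termination
  by (relation "measure (\<lambda>(b, c, m). nat \<bar>2 * m - 3\<bar>)") auto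

declare cluster_var.simps [simp del]

inductive_set cluster_algebra :: "nat \<Rightarrow> nat \<Rightarrow> ratfun2 set" for b c :: nat where
  var: "cluster_var b c m \<in> cluster_algebra b c"
| one: "1 \<in> cluster_algebra b c"
| diff: "x \<in> cluster_algebra b c \<Longrightarrow> y \<in> cluster_algebra b c \<Longrightarrow> x - y \<in> cluster_algebra b c"
| mult: "x \<in> cluster_algebra b c \<Longrightarrow> y \<in> cluster_algebra b c \<Longrightarrow> x * y \<in> cluster_algebra b c"

definition has_expansion ::
    "nat \<Rightarrow> nat \<Rightarrow> int \<Rightarrow> int \<Rightarrow> (nat \<Rightarrow> nat \<Rightarrow> int) \<Rightarrow> ratfun2 \<Rightarrow> bool" where
  "has_expansion b c a1 a2 e x \<longleftrightarrow>
     finite {(p, q). e p q \<noteq> 0} \<and>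
     x = X1 powi (- a1) * X2 powi (- a2) *
         (\<Sum>(p, q) \<in> {(p, q). e p q \<noteq> 0}. of_int (e p q) * X1 ^ (b * p) * X2 ^ (c * q))"

definition pointed_with ::
    "nat \<Rightarrow> nat \<Rightarrow> int \<Rightarrow> int \<Rightarrow> (nat \<Rightarrow> nat \<Rightarrow> int) \<Rightarrow> ratfun2 \<Rightarrow> bool" where
  "pointed_with b c a1 a2 e x \<longleftrightarrow>
     x \<in> cluster_algebra b c \<and> has_expansion b c a1 a2 e x \<and> e 0 0 = 1"

(* The function nat truncates negative integers to 0, so nat a is the positive part of a.
   The truncated subtraction of 1 is harmless since k, l >= 1. *)
definition greedy_recurrence ::
    "nat \<Rightarrow> nat \<Rightarrow> int \<Rightarrow> int \<Rightarrow> (nat \<Rightarrow> nat \<Rightarrow> int) \<Rightarrow> bool" where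
  "greedy_recurrence b c a1 a2 e \<longleftrightarrow>
     (\<forall>p q. (p, q) \<noteq> (0, 0) \<longrightarrow>
        (int c * a1 * int q \<le> int b * a2 * int p \<longrightarrow>
           e p q = (\<Sum>k = 1..p. (-1) ^ (k - 1) * e (p - k) q *
                       int ((nat (a2 - int c * int q) + k - 1) choose k))) \<and>
        (int c * a1 * int q \<ge> int b * a2 * int p \<longrightarrow>
           e p q = (\<Sum>l = 1..q. (-1) ^ (l - 1) * e p (q - l) *
                       int ((nat (a1 - int b * int p) + l - 1) choose l))))"

(* The predicate "x is the greedy element x[a1, a2]"; by greedy_element_unique below there is at
   most one such x. *)
definition greedy_element :: "nat \<Rightarrow> nat \<Rightarrow> int \<Rightarrow> int \<Rightarrow> ratfun2 \<Rightarrow> bool" where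
  "greedy_element b c a1 a2 x \<longleftrightarrow>
     (\<exists>e. pointed_with b c a1 a2 e x \<and> greedy_recurrence b c a1 a2 e)"

definition pos_imaginary_roots :: "nat \<Rightarrow> nat \<Rightarrow> (int \<times> int) set" where
  "pos_imaginary_roots b c =
     {(a1, a2). a1 > 0 \<and> a2 > 0 \<and>
        int c * a1\<^sup>2 - int b * int c * a1 * a2 + int b * a2\<^sup>2 \<le> 0}"

definition R_greedy :: "nat \<Rightarrow> nat \<Rightarrow> int \<Rightarrow> int \<Rightarrow> (real \<times> real) set" where
  "R_greedy b c a1 a2 =
     {(p, q). p \<ge> 0 \<and> q \<ge> 0 \<and>
        (q + (real b - (real b * real_of_int a2) / (real c * real_of_int a1)) * p < real_of_int a1 \<or>
         p + (real c - (real c * real_of_int a1) / (real b * real_of_int a2)) * q < real_of_int a2)}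
     \<union> {(0, real_of_int a1), (real_of_int a2, 0)}"

definition support_axiom ::
    "nat \<Rightarrow> nat \<Rightarrow> int \<Rightarrow> int \<Rightarrow> (nat \<Rightarrow> nat \<Rightarrow> int) \<Rightarrow> bool" where
  "support_axiom b c a1 a2 e \<longleftrightarrow>
     (\<forall>p q. (real p, real q) \<notin> R_greedy b c a1 a2 \<longrightarrow> e p q = 0)"

(* "(1 + t)^n divides the sum of the f i * t^i in Z[t]", which includes that this sum is finite. *)
definition one_plus_t_power_dvd :: "nat \<Rightarrow> (nat \<Rightarrow> int) \<Rightarrow> bool" where
  "one_plus_t_power_dvd n f \<longleftrightarrow> (\<exists>P :: int poly. coeff P = f \<and> [:1, 1:] ^ n dvd P)"

definition divisibility_axiom ::
    "nat \<Rightarrow> nat \<Rightarrow> int \<Rightarrow> int \<Rightarrow> (nat \<Rightarrow> nat \<Rightarrow> int) \<Rightarrow> bool" where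
  "divisibility_axiom b c a1 a2 e \<longleftrightarrow>
     (\<forall>p q.
        (a2 > int c * int q \<longrightarrow>
           one_plus_t_power_dvd (nat (a2 - int c * int q)) (\<lambda>i. e i q)) \<and>
        (a1 > int b * int p \<longrightarrow>
           one_plus_t_power_dvd (nat (a1 - int b * int p)) (\<lambda>i. e p i)))"

(* Quotients of polynomials that are positive at x1 = x2 = 1; used for nonvanishing. *)
definition pos_ratfun :: "ratfun2 \<Rightarrow> bool" where
  "pos_ratfun f \<longleftrightarrow>
     (\<exists>p q. f = to_fract p / to_fract q \<and> poly (poly p 1) 1 > 0 \<and> poly (poly q 1) 1 > 0)"

lemma pos_ratfun_nonzero: "pos_ratfun f \<Longrightarrow> f \<noteq> 0"
  by (auto simp: pos_ratfun_def)

lemma pos_ratfun_one: "pos_ratfun 1"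
  unfolding pos_ratfun_def by (intro exI[of _ 1]) auto

lemma pos_ratfun_X1: "pos_ratfun X1"
  unfolding pos_ratfun_def X1_def
  by (rule exI[of _ "[:[:0, 1:]:]"], rule exI[of _ 1]) auto

lemma pos_ratfun_X2: "pos_ratfun X2"
  unfolding pos_ratfun_def X2_def
  by (rule exI[of _ "[:0, 1:]"], rule exI[of _ 1]) auto

lemma pos_ratfun_add:
  assumes "pos_ratfun f" "pos_ratfun g"
  shows "pos_ratfun (f + g)"
proof -
  obtain p q where f: "f = to_fract p / to_fract q"
    and pq: "poly (poly p 1) 1 > 0" "poly (poly q 1) 1 > 0"
    using assms(1) by (auto simp: pos_ratfun_def)
  obtain r s where g: "g = to_fract r / to_fract s"
    and rs: "poly (poly r 1) 1 > 0" "poly (poly s 1) 1 > 0"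
    using assms(2) by (auto simp: pos_ratfun_def)
  have "q \<noteq> 0" "s \<noteq> 0" using pq rs by auto
  then have "f + g = to_fract (p * s + r * q) / to_fract (q * s)"
    by (simp add: f g field_simps)
  then show ?thesis
    unfolding pos_ratfun_def using pq rs
    by (intro exI[of _ "p * s + r * q"] exI[of _ "q * s"]) (auto intro: add_pos_pos)
qed

lemma pos_ratfun_mult:
  assumes "pos_ratfun f" "pos_ratfun g"
  shows "pos_ratfun (f * g)"
proof -
  obtain p q where f: "f = to_fract p / to_fract q"
    and pq: "poly (poly p 1) 1 > 0" "poly (poly q 1) 1 > 0"
    using assms(1) by (auto simp: pos_ratfun_def)
  obtain r s where g: "g = to_fract r / to_fract s"
    and rs: "poly (poly r 1) 1 > 0" "poly (poly s 1) 1 > 0"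
    using assms(2) by (auto simp: pos_ratfun_def)
  show ?thesis
    unfolding pos_ratfun_def using pq rs
    by (intro exI[of _ "p * r"] exI[of _ "q * s"]) (auto simp: f g)
qed

lemma pos_ratfun_inverse: "pos_ratfun f \<Longrightarrow> pos_ratfun (inverse f)"
  unfolding pos_ratfun_def by (metis inverse_divide)

lemma pos_ratfun_divide: "pos_ratfun f \<Longrightarrow> pos_ratfun g \<Longrightarrow> pos_ratfun (f / g)"
  by (simp add: divide_inverse pos_ratfun_mult pos_ratfun_inverse)

lemma pos_ratfun_power: "pos_ratfun f \<Longrightarrow> pos_ratfun (f ^ n)"
  by (induction n) (auto simp: pos_ratfun_one pos_ratfun_mult)

lemma pos_ratfun_cluster_var: "pos_ratfun (cluster_var b c m)"
proof (induction b c m rule: cluster_var.induct)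
  case (1 b c m)
  show ?case
    by (subst cluster_var.simps)
      (use 1 in \<open>auto intro!: pos_ratfun_X1 pos_ratfun_X2 pos_ratfun_divide pos_ratfun_add
        pos_ratfun_power pos_ratfun_one\<close>)
qed

lemma cluster_var_nonzero: "cluster_var b c m \<noteq> 0"
  using pos_ratfun_cluster_var pos_ratfun_nonzero by blast

lemma cluster_var_exchange:
  "cluster_var b c (m + 1) * cluster_var b c (m - 1) =
     cluster_var b c m ^ (if odd m then b else c) + 1"
proof (cases "m \<ge> 2")
  case True
  then have "cluster_var b c (m + 1) =
      (cluster_var b c m ^ exch_exp b c m + 1) / cluster_var b c (m - 1)"
    by (subst cluster_var.simps) (auto simp: algebra_simps)
  then show ?thesis
    using cluster_var_nonzero[of b c "m - 1"] by (simp add: exch_exp_def)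
next
  case False
  then have "cluster_var b c (m - 1) =
      (cluster_var b c m ^ exch_exp b c m + 1) / cluster_var b c (m + 1)"
    by (subst cluster_var.simps) (auto simp: algebra_simps)
  then show ?thesis
    using cluster_var_nonzero[of b c "m + 1"] by (simp add: exch_exp_def)
qed

lemma greedy_recurrence_unique:
  assumes "greedy_recurrence b c a1 a2 e" "e 0 0 = 1"
    and "greedy_recurrence b c a1 a2 e'" "e' 0 0 = 1"
  shows "e p q = e' p q"
proof (induction "p + q" arbitrary: p q rule: less_induct)
  case less
  consider "(p, q) = (0, 0)"
    | "(p, q) \<noteq> (0, 0)" "int c * a1 * int q \<le> int b * a2 * int p"
    | "(p, q) \<noteq> (0, 0)" "int c * a1 * int q \<ge> int b * a2 * int p"
    by linarith
  then show ?case
  proof cases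
    case 1
    then show ?thesis using assms by simp
  next
    case 2
    have *: "f p q = (\<Sum>k = 1..p. (-1) ^ (k - 1) * f (p - k) q *
               int ((nat (a2 - int c * int q) + k - 1) choose k))"
      if "greedy_recurrence b c a1 a2 f" for f
      using that 2 unfolding greedy_recurrence_def by blast
    have "e (p - k) q = e' (p - k) q" if "k \<in> {1..p}" for k
      using that by (intro less) auto
    then show ?thesis
      unfolding *[OF assms(1)] *[OF assms(3)] by (intro sum.cong) auto
  next
    case 3
    have *: "f p q = (\<Sum>l = 1..q. (-1) ^ (l - 1) * f p (q - l) *
               int ((nat (a1 - int b * int p) + l - 1) choose l))"
      if "greedy_recurrence b c a1 a2 f" for f
      using that 3 unfolding greedy_recurrence_def by blast
    have "e p (q - l) = e' p (q - l)" if "l \<in> {1..q}" for l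
      using that by (intro less) auto
    then show ?thesis
      unfolding *[OF assms(1)] *[OF assms(3)] by (intro sum.cong) auto
  qed
qed

lemma greedy_element_unique:
  assumes "greedy_element b c a1 a2 x" "greedy_element b c a1 a2 y"
  shows "x = y"
proof -
  obtain e where e: "pointed_with b c a1 a2 e x" "greedy_recurrence b c a1 a2 e"
    using assms(1) by (auto simp: greedy_element_def)
  obtain e' where e': "pointed_with b c a1 a2 e' y" "greedy_recurrence b c a1 a2 e'"
    using assms(2) by (auto simp: greedy_element_def)
  have "e = e'"
    using greedy_recurrence_unique[OF e(2) _ e'(2)] e(1) e'(1)
    by (auto simp: pointed_with_def)
  then show ?thesis
    using e(1) e'(1) by (simp add: pointed_with_def has_expansion_def)
qed

end

theory Submission
  imports Defs "HOL-Computational_Algebra.Polynomial_FPS"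
begin

text \<open>
  The sum in the greedy recurrence for row \<open>q\<close> is designed so that the recurrence at \<open>(p, q)\<close> says
  that the coefficient of \<open>t^p\<close> in \<open>(1 + t)^(-n) * f\<close> vanishes, where \<open>f\<close> is the generating
  function of the row and \<open>n = [a2 - c q]_+\<close>.  As the recurrence is imposed for all \<open>p\<close> from some
  threshold \<open>d\<close> on, it amounts to \<open>f\<close> being \<open>(1 + t)^n\<close> times a polynomial of degree below \<open>d\<close>,
  that is, to divisibility together with a bound on the support of the row.  For imaginary roots,
  these bounds for all rows and all columns are together equivalent to the support axiom.
\<close>

section \<open>Expansion of \<open>(1 + t)^(-n)\<close> and the recurrence as divisibility\<close>

definition neg_binomial_sum :: "nat \<Rightarrow> (nat \<Rightarrow> int) \<Rightarrow> nat \<Rightarrow> int" where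
  "neg_binomial_sum n f p =
     (\<Sum>k = 1..p. (-1) ^ (k - 1) * f (p - k) * int ((n + k - 1) choose k))"

text \<open>The binomial series of \<open>(1 + t)^(-n)\<close>. For \<open>n = 0\<close> it is 1: at
  \<open>k = 0\<close> the truncated subtraction yields \<open>0 choose 0\<close>, and
  \<open>(k - 1) choose k\<close> vanishes for \<open>k > 0\<close>.\<close>

definition neg_binomial_fps :: "nat \<Rightarrow> int fps" where
  "neg_binomial_fps n = Abs_fps (\<lambda>k. (-1) ^ k * int ((n + k - 1) choose k))"

text \<open>Coefficientwise this is Pascal's rule.\<close>

lemma neg_binomial_fps_Suc: "neg_binomial_fps (Suc n) * (1 + fps_X) = neg_binomial_fps n"
proof (rule fps_ext)
  fix k
  show "fps_nth (neg_binomial_fps (Suc n) * (1 + fps_X)) k = fps_nth (neg_binomial_fps n) k"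
    by (cases k) (simp_all add: neg_binomial_fps_def distrib_left algebra_simps)
qed

lemma neg_binomial_fps_mult_power: "neg_binomial_fps n * (1 + fps_X) ^ n = 1"
proof (induction n)
  case 0
  have "neg_binomial_fps 0 = 1"
    by (rule fps_ext) (simp add: neg_binomial_fps_def binomial_eq_0)
  then show ?case by simp
next
  case (Suc n)
  then show ?case by (simp add: neg_binomial_fps_Suc flip: mult.assoc)
qed

lemma fps_nth_neg_binomial_fps_mult:
  "fps_nth (neg_binomial_fps n * Abs_fps f) p = f p - neg_binomial_sum n f p"
proof -
  have "fps_nth (neg_binomial_fps n * Abs_fps f) p =
      (\<Sum>k = 0..p. (-1) ^ k * int ((n + k - 1) choose k) * f (p - k))"
    by (simp add: fps_mult_nth neg_binomial_fps_def)
  also have "\<dots> = f p + (\<Sum>k = 1..p. (-1) ^ k * int ((n + k - 1) choose k) * f (p - k))"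
    by (simp add: sum.atLeast_Suc_atMost)
  also have "(\<Sum>k = 1..p. (-1) ^ k * int ((n + k - 1) choose k) * f (p - k)) =
      - neg_binomial_sum n f p"
    unfolding neg_binomial_sum_def sum_negf [symmetric]
  proof (rule sum.cong)
    fix k assume "k \<in> {1..p}"
    then have "(-1) ^ k = - ((-1) ^ (k - 1) :: int)"
      by (cases k) auto
    then show "(-1) ^ k * int ((n + k - 1) choose k) * f (p - k) =
        - ((-1) ^ (k - 1) * f (p - k) * int ((n + k - 1) choose k))"
      by simp
  qed simp
  finally show ?thesis by simp
qed

lemma fps_of_poly_one_plus_t_power: "fps_of_poly ([:1, 1:] ^ n) = (1 + fps_X :: int fps) ^ n"
  by (simp add: fps_of_poly_power fps_of_poly_linear add.commute)

text \<open>The recurrence from \<open>d\<close> on makes the quotient \<open>G\<close> of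
  \<open>f\<close> by \<open>(1 + t)^n\<close> a polynomial without terms of degree \<open>d\<close>
  or more. Degrees add over the integers, so bounding \<open>G\<close> by \<open>d\<close> is the
  same as bounding \<open>f\<close> by \<open>n + d\<close>.\<close>

lemma neg_binomial_recurrence_iff:
  "(\<forall>p\<ge>d. f p = neg_binomial_sum n f p) \<longleftrightarrow>
     one_plus_t_power_dvd n f \<and> (\<forall>p\<ge>n + d. f p = 0)"
proof
  assume rec: "\<forall>p\<ge>d. f p = neg_binomial_sum n f p"
  define g where "g = neg_binomial_fps n * Abs_fps f"
  have g0: "fps_nth g p = 0" if "p \<ge> d" for p
    using rec that by (simp add: g_def fps_nth_neg_binomial_fps_mult)
  define G where "G = Abs_poly (fps_nth g)"
  have coeff_G: "coeff G = fps_nth g"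
    unfolding G_def by (rule Abs_poly_inverse) (use g0 in \<open>auto simp: MOST_nat_le\<close>)
  then have G: "fps_of_poly G = g"
    by (simp add: fps_of_poly_def fps_nth_inverse)
  have "fps_of_poly ([:1, 1:] ^ n * G) = neg_binomial_fps n * (1 + fps_X) ^ n * Abs_fps f"
    by (simp add: fps_of_poly_mult fps_of_poly_one_plus_t_power G g_def mult_ac)
  then have f: "coeff ([:1, 1:] ^ n * G) = f"
    by (simp add: neg_binomial_fps_mult_power fps_of_poly_def fun_eq_iff fps_eq_iff)
  \<comment> \<open>The case \<open>G = 0\<close> is set apart because its degree 0 is not below
    \<open>d\<close> when \<open>d = 0\<close>.\<close>
  have "f p = 0" if p: "p \<ge> n + d" for p
  proof (cases "G = 0")
    case True
    then show ?thesis using f by auto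
  next
    case False
    then have "degree G < d"
      using g0 coeff_G by (metis leading_coeff_0_iff not_le)
    then have "degree ([:1, 1:] ^ n * G) < p"
      using p False by (simp add: degree_mult_eq degree_power_eq)
    then show ?thesis using f coeff_eq_0 by blast
  qed
  with f show "one_plus_t_power_dvd n f \<and> (\<forall>p\<ge>n + d. f p = 0)"
    unfolding one_plus_t_power_dvd_def by (metis dvd_triv_left)
next
  assume *: "one_plus_t_power_dvd n f \<and> (\<forall>p\<ge>n + d. f p = 0)"
  then obtain G where f: "coeff ([:1, 1:] ^ n * G) = f"
    unfolding one_plus_t_power_dvd_def by (metis dvdE)
  have "Abs_fps f = fps_of_poly ([:1, 1:] ^ n * G)"
    by (simp only: f fps_of_poly_def)
  then have "neg_binomial_fps n * Abs_fps f =
      neg_binomial_fps n * (1 + fps_X) ^ n * fps_of_poly G"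
    by (simp add: fps_of_poly_mult fps_of_poly_one_plus_t_power mult.assoc)
  then have coeff_G: "coeff G p = f p - neg_binomial_sum n f p" for p
    using fps_nth_neg_binomial_fps_mult[of n f p] by (simp add: neg_binomial_fps_mult_power)
  have "coeff G p = 0" if "p \<ge> d" for p
  proof (cases "G = 0")
    case False
    then have "degree ([:1, 1:] ^ n * G) = n + degree G"
      by (simp add: degree_mult_eq degree_power_eq)
    moreover have "coeff ([:1, 1:] ^ n * G) (degree ([:1, 1:] ^ n * G)) \<noteq> 0"
      using False by (simp only: leading_coeff_0_iff) simp
    ultimately have "degree G < d"
      using * f by (metis not_le add_le_cancel_left)
    then show ?thesis using that by (simp add: coeff_eq_0)
  qed simp
  then show "\<forall>p\<ge>d. f p = neg_binomial_sum n f p"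
    using coeff_G by simp
qed

section \<open>Rows and columns of the greedy recurrence\<close>

definition row_recurrence ::
    "nat \<Rightarrow> nat \<Rightarrow> int \<Rightarrow> int \<Rightarrow> (nat \<Rightarrow> nat \<Rightarrow> int) \<Rightarrow> bool" where
  "row_recurrence b c a1 a2 e \<longleftrightarrow>
     (\<forall>p q. (p, q) \<noteq> (0, 0) \<longrightarrow> int c * a1 * int q \<le> int b * a2 * int p \<longrightarrow>
        e p q = neg_binomial_sum (nat (a2 - int c * int q)) (\<lambda>i. e i q) p)"

text \<open>The two clauses are mirror images: exchanging \<open>b\<close> with \<open>c\<close> and
  \<open>a1\<close> with \<open>a2\<close> and transposing \<open>e\<close> turns columns into rows.
  Results on rows thus serve columns too.\<close>

lemma greedy_recurrence_iff_rows:
  "greedy_recurrence b c a1 a2 e \<longleftrightarrow>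
     row_recurrence b c a1 a2 e \<and> row_recurrence c b a2 a1 (\<lambda>p q. e q p)"
  unfolding greedy_recurrence_def row_recurrence_def neg_binomial_sum_def
  by (auto simp del: One_nat_def)

text \<open>The indices \<open>p\<close> at which row \<open>q\<close> is constrained form an
  up-closed nonempty set, and \<open>d\<close> is its least element. For \<open>q = 0\<close> the
  exclusion of the origin makes it 1.\<close>

lemma row_threshold:
  fixes b c :: nat and a1 a2 :: int
  assumes "b > 0" "a2 > 0"
  obtains d where "\<And>p. d \<le> p \<longleftrightarrow> (p, q) \<noteq> (0, 0) \<and> int c * a1 * int q \<le> int b * a2 * int p"
proof -
  define P where "P p \<longleftrightarrow> (p, q) \<noteq> (0, 0) \<and> int c * a1 * int q \<le> int b * a2 * int p" for p
  have mono: "P p'" if "P p" "p \<le> p'" for p p'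
  proof -
    have "int b * a2 * int p \<le> int b * a2 * int p'"
      using assms that(2) by (intro mult_left_mono) auto
    then show ?thesis using that by (auto simp: P_def)
  qed
  \<comment> \<open>Since \<open>b * a2 >= 1\<close>, any \<open>N >= c * a1 * q\<close> satisfies
    the inequality; \<open>Suc\<close> keeps \<open>(N, q)\<close> away from the origin.\<close>
  define N where "N = Suc (nat (int c * a1 * int q))"
  have "0 < int b * a2" using assms by simp
  then have "1 * int N \<le> int b * a2 * int N"
    by (intro mult_right_mono) auto
  moreover have "int c * a1 * int q \<le> int N" by (simp add: N_def)
  ultimately have "P N" by (simp add: P_def N_def)
  then have "(LEAST p. P p) \<le> p \<longleftrightarrow> P p" for p
    using mono LeastI[of P N] Least_le[of P p] by blast
  then show thesis using that unfolding P_def by blast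
qed

text \<open>The bound \<open>p >= n + d\<close> splits into \<open>p >= n\<close> and
  \<open>p - n >= d\<close>, and the latter is the defining condition of the threshold at
  \<open>p - n\<close>. In rows with \<open>n = 0\<close> the divisibility still says that the row
  is finite.\<close>

lemma row_recurrence_iff:
  assumes "b > 0" "a2 > 0"
  shows "row_recurrence b c a1 a2 e \<longleftrightarrow>
    (\<forall>q. one_plus_t_power_dvd (nat (a2 - int c * int q)) (\<lambda>i. e i q) \<and>
      (\<forall>p\<ge>nat (a2 - int c * int q).
        (p - nat (a2 - int c * int q), q) \<noteq> (0, 0) \<longrightarrow>
        int c * a1 * int q \<le> int b * a2 * int (p - nat (a2 - int c * int q)) \<longrightarrow> e p q = 0))"
    (is "_ \<longleftrightarrow> (\<forall>q. ?R q)")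
proof -
  have "(\<forall>p. (p, q) \<noteq> (0, 0) \<longrightarrow> int c * a1 * int q \<le> int b * a2 * int p \<longrightarrow>
        e p q = neg_binomial_sum (nat (a2 - int c * int q)) (\<lambda>i. e i q) p) \<longleftrightarrow> ?R q" for q
  proof -
    define n where "n = nat (a2 - int c * int q)"
    obtain d where d:
      "\<And>p. d \<le> p \<longleftrightarrow> (p, q) \<noteq> (0, 0) \<and> int c * a1 * int q \<le> int b * a2 * int p"
      using row_threshold[OF assms] by metis
    have "(\<forall>p\<ge>n + d. e p q = 0) \<longleftrightarrow> (\<forall>p\<ge>n. d \<le> p - n \<longrightarrow> e p q = 0)"
      by (metis add_leD1 le_diff_conv2 add.commute)
    then show ?thesis
      using neg_binomial_recurrence_iff[of d "\<lambda>i. e i q" n] unfolding d n_def by blast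
  qed
  then show ?thesis unfolding row_recurrence_def by blast
qed

text \<open>The two inequalities defining \<open>R_greedy\<close>, multiplied by \<open>c a1\<close> and \<open>b a2\<close>.\<close>

definition in_region :: "nat \<Rightarrow> nat \<Rightarrow> int \<Rightarrow> int \<Rightarrow> nat \<Rightarrow> nat \<Rightarrow> bool" where
  "in_region b c a1 a2 p q \<longleftrightarrow>
     int c * a1 * int q + (int b * int c * a1 - int b * a2) * int p < int c * a1 * a1 \<or>
     int b * a2 * int p + (int b * int c * a2 - int c * a1) * int q < int b * a2 * a2 \<or>
     p = 0 \<and> int q = a1 \<or> int p = a2 \<and> q = 0"

lemma in_region_swap: "in_region c b a2 a1 q p \<longleftrightarrow> in_region b c a1 a2 p q"
  unfolding in_region_def by (auto simp: mult.commute[of "int c" "int b"])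

lemma clear_denominator_less:
  fixes b c p q :: nat and a1 a2 :: int
  assumes "c > 0" "a1 > 0"
  shows "real q + (real b - (real b * real_of_int a2) / (real c * real_of_int a1)) * real p
      < real_of_int a1 \<longleftrightarrow>
    int c * a1 * int q + (int b * int c * a1 - int b * a2) * int p < int c * a1 * a1"
    (is "?l < _ \<longleftrightarrow> ?i < ?j")
proof -
  have pos: "real c * real_of_int a1 > 0" using assms by simp
  have "?l < real_of_int a1 \<longleftrightarrow>
      real c * real_of_int a1 * ?l < real c * real_of_int a1 * real_of_int a1"
    using pos by (rule mult_less_cancel_left_pos [symmetric])
  also have "real c * real_of_int a1 * ?l = real_of_int ?i"
    using assms by (simp add: field_simps)
  also have "real c * real_of_int a1 * real_of_int a1 = real_of_int ?j"
    by simp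
  finally show ?thesis by (simp only: of_int_less_iff)
qed

lemma R_greedy_iff:
  assumes "b > 0" "c > 0" "a1 > 0" "a2 > 0"
  shows "(real p, real q) \<in> R_greedy b c a1 a2 \<longleftrightarrow> in_region b c a1 a2 p q"
proof -
  have eq: "real n = real_of_int a \<longleftrightarrow> int n = a" for n a
    by (metis of_int_eq_iff of_int_of_nat_eq)
  show ?thesis
    unfolding R_greedy_def in_region_def
    using clear_denominator_less[OF assms(2,3), of q b a2 p]
      clear_denominator_less[OF assms(1,4), of p c a1 q]
    by (auto simp: eq mult.commute[of "int c" "int b"])
qed

section \<open>From the recurrence to the axioms\<close>

text \<open>With \<open>n = a2 - c * q\<close> substituted, the degree bound of a low row is exactly
  the second inequality of the region. The exempted origin, shifted by \<open>n\<close>, becomes the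
  isolated point \<open>(a2, 0)\<close>.\<close>

lemma in_region_of_row:
  assumes "b > 0" "a1 > 0" "a2 > 0" and rec: "row_recurrence b c a1 a2 e"
    and row: "int c * int q < a2" and "e p q \<noteq> 0"
  shows "in_region b c a1 a2 p q"
proof -
  define n where "n = nat (a2 - int c * int q)"
  have n: "int n = a2 - int c * int q" using row by (simp add: n_def)
  have lt: "int b * a2 * (int p - int n) < int c * a1 * int q \<or> p = n \<and> q = 0"
  proof (cases "p < n")
    case True
    then have "int b * a2 * (int p - int n) < 0"
      using assms by (intro mult_pos_neg) auto
    moreover have "0 \<le> int c * a1 * int q" using assms by simp
    ultimately show ?thesis by linarith
  next
    case False
    then have "(p - n, q) \<noteq> (0, 0) \<longrightarrow>
        \<not> int c * a1 * int q \<le> int b * a2 * int (p - n)"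
      using rec assms(6) unfolding row_recurrence_iff[OF assms(1,3)] n_def
      by (meson not_le)
    moreover have "int (p - n) = int p - int n" using False by simp
    ultimately show ?thesis using False by auto
  qed
  then show ?thesis
  proof
    assume "int b * a2 * (int p - int n) < int c * a1 * int q"
    then show ?thesis
      unfolding in_region_def n by (simp add: algebra_simps)
  qed (use n in \<open>auto simp: in_region_def\<close>)
qed

text \<open>Here \<open>n = 0\<close>, so the vanishing clause applies at \<open>p\<close>
  itself.\<close>

lemma row_recurrence_outside:
  assumes "b > 0" "a1 > 0" "a2 > 0" "row_recurrence b c a1 a2 e"
    and "a2 \<le> int c * int q" "int c * a1 * int q \<le> int b * a2 * int p"
  shows "e p q = 0"
proof -
  have "(p, q) \<noteq> (0, 0)" using assms by auto
  then show ?thesis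
    using assms(4-6) unfolding row_recurrence_iff[OF assms(1,3)] by auto
qed

lemma greedy_recurrence_imp_support:
  assumes pos: "b > 0" "c > 0" "a1 > 0" "a2 > 0" and "greedy_recurrence b c a1 a2 e"
  shows "support_axiom b c a1 a2 e"
proof -
  have rows: "row_recurrence b c a1 a2 e" "row_recurrence c b a2 a1 (\<lambda>p q. e q p)"
    using assms(5) by (auto simp: greedy_recurrence_iff_rows)
  have "in_region b c a1 a2 p q" if nz: "e p q \<noteq> 0" for p q
  proof -
    consider "int c * int q < a2" | "int b * int p < a1"
      | "a2 \<le> int c * int q" "a1 \<le> int b * int p" by linarith
    then show ?thesis
    proof cases
      case 1
      then show ?thesis using in_region_of_row pos rows(1) nz by blast
    next
      case 2
      then show ?thesis
        using in_region_of_row[OF pos(2,4,3) rows(2), of p q] nz in_region_swap by blast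
    next
      \<comment> \<open>Rows kill the points on or below the line
        \<open>c * a1 * q = b * a2 * p\<close>, columns those on or above it, so no support remains
        in this quadrant.\<close>
      case 3
      then show ?thesis
        using row_recurrence_outside[OF pos(1,3,4) rows(1), of q p]
          row_recurrence_outside[OF pos(2,4,3) rows(2), of p q] nz by linarith
    qed
  qed
  then show ?thesis
    unfolding support_axiom_def R_greedy_iff[OF pos] by blast
qed

lemma greedy_recurrence_imp_divisibility:
  assumes "b > 0" "c > 0" "a1 > 0" "a2 > 0" "greedy_recurrence b c a1 a2 e"
  shows "divisibility_axiom b c a1 a2 e"
  using assms(5)
  unfolding greedy_recurrence_iff_rows row_recurrence_iff[OF assms(1,4)]
    row_recurrence_iff[OF assms(2,3)] divisibility_axiom_def by blast

section \<open>Geometry of imaginary roots and the converse\<close>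

text \<open>The quadratic inequality bounds \<open>b * a2 * (c * a1 - a2)\<close> below by
  \<open>c * a1^2\<close>. The positive factor \<open>c * a1 - a2\<close> is what the two bounding
  lines are compared with.\<close>

lemma imaginary_root_bound:
  fixes b c a1 a2 :: int
  assumes "b > 0" "c > 0" "a1 > 0" "a2 > 0" "c * a1\<^sup>2 - b * c * a1 * a2 + b * a2\<^sup>2 \<le> 0"
  shows "a2 < c * a1"
proof -
  have "0 < c * a1\<^sup>2" using assms by simp
  moreover have "b * a2 * (c * a1 - a2) = b * c * a1 * a2 - b * a2\<^sup>2"
    by (simp add: power2_eq_square algebra_simps)
  ultimately have "0 < b * a2 * (c * a1 - a2)" using assms(5) by linarith
  moreover have "0 < b * a2" using assms by simp
  ultimately show ?thesis by (simp add: zero_less_mult_iff)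
qed

text \<open>
  The two lines bounding the region meet at \<open>(a1/b, a2/c)\<close>.  Below that height the first half-plane
  lies inside the second one, because the root is imaginary.
\<close>

lemma half_plane_inclusion:
  fixes b c a1 a2 p q :: int
  assumes "b > 0" "c > 0" "a1 > 0" "a2 > 0"
    and im: "c * a1\<^sup>2 - b * c * a1 * a2 + b * a2\<^sup>2 \<le> 0"
    and q: "c * q \<le> a2"
    and lt: "c * a1 * q + (b * c * a1 - b * a2) * p < c * a1 * a1"
  shows "b * a2 * p + (b * c * a2 - c * a1) * q < b * a2 * a2"
proof -
  \<comment> \<open>\<open>D\<close> is minus the quadratic form of the root. The factor
    \<open>u\<close> makes the coefficients of \<open>p\<close> in the two inequalities match,
    leaving a multiple of \<open>a2 - c * q\<close> with coefficient \<open>D\<close>.\<close>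
  define D where "D = b * c * a1 * a2 - c * a1\<^sup>2 - b * a2\<^sup>2"
  define u where "u = c * a1 - a2"
  have u: "u > 0" using imaginary_root_bound[OF assms(1-5)] by (simp add: u_def)
  have "D \<ge> 0" using im by (simp add: D_def)
  then have "D * (a2 - c * q) \<ge> 0" using q by simp
  moreover have "u * (b * a2 * a2 - (b * a2 * p + (b * c * a2 - c * a1) * q)) =
      a2 * (c * a1 * a1 - (c * a1 * q + (b * c * a1 - b * a2) * p)) + D * (a2 - c * q)"
    unfolding D_def u_def by (simp add: algebra_simps power2_eq_square)
  moreover have "a2 * (c * a1 * a1 - (c * a1 * q + (b * c * a1 - b * a2) * p)) > 0"
    using lt assms by simp
  ultimately have "u * (b * a2 * a2 - (b * a2 * p + (b * c * a2 - c * a1) * q)) > 0" by linarith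
  then show ?thesis using u by (simp add: zero_less_mult_iff)
qed

text \<open>Replacing \<open>b * a2 * p\<close> by the smaller \<open>c * a1 * q\<close>, in the
  first bound after multiplication by \<open>a2\<close>, leaves a multiple of \<open>c * q\<close>,
  which is at least \<open>a2\<close>. So points where a high row must vanish satisfy neither
  inequality.\<close>

lemma half_planes_avoided:
  fixes b c a1 a2 p q :: int
  assumes pos: "b > 0" "c > 0" "a1 > 0" "a2 > 0"
    and im: "c * a1\<^sup>2 - b * c * a1 * a2 + b * a2\<^sup>2 \<le> 0"
    and q: "a2 \<le> c * q" and p: "c * a1 * q \<le> b * a2 * p"
  shows "c * a1 * a1 \<le> c * a1 * q + (b * c * a1 - b * a2) * p"
    and "b * a2 * a2 \<le> b * a2 * p + (b * c * a2 - c * a1) * q"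
proof -
  have "c * a1 - a2 > 0" using imaginary_root_bound[OF pos im] by simp
  then have "(c * a1 - a2) * (c * a1 * q) \<le> (c * a1 - a2) * (b * a2 * p)"
    using p by simp
  moreover have "c * a1 * a1 * a2 \<le> c * a1 * a1 * (c * q)"
    using pos q by simp
  ultimately have "a2 * (c * a1 * a1) \<le> a2 * (c * a1 * q + (b * c * a1 - b * a2) * p)"
    by (simp add: algebra_simps)
  then show "c * a1 * a1 \<le> c * a1 * q + (b * c * a1 - b * a2) * p"
    using pos by simp
  have "b * a2 * a2 \<le> b * a2 * (c * q)" using pos q by simp
  then show "b * a2 * a2 \<le> b * a2 * p + (b * c * a2 - c * a1) * q"
    using p by (simp add: algebra_simps)
qed

text \<open>The divisor is 1, so only the finiteness built into the predicate is at stake.\<close>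

lemma one_plus_t_power_dvd_0:
  assumes "\<And>p. p \<ge> d \<Longrightarrow> f p = 0"
  shows "one_plus_t_power_dvd 0 f"
proof -
  have "coeff (Abs_poly f) = f"
    by (rule Abs_poly_inverse) (use assms in \<open>auto simp: MOST_nat_le\<close>)
  then show ?thesis unfolding one_plus_t_power_dvd_def by auto
qed

text \<open>It suffices that every point where the row criterion demands zero lies off the region:
  \<open>outside\<close> treats the rows with \<open>c * q >= a2\<close>, \<open>inside\<close> the
  lower ones.\<close>

lemma row_recurrence_of_axioms:
  assumes pos: "b > 0" "c > 0" "a1 > 0" "a2 > 0"
    and im: "int c * a1\<^sup>2 - int b * int c * a1 * a2 + int b * a2\<^sup>2 \<le> 0"
    and supp: "\<And>p q. e p q \<noteq> 0 \<Longrightarrow> in_region b c a1 a2 p q"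
    and dvd: "\<And>q. int c * int q < a2 \<Longrightarrow>
      one_plus_t_power_dvd (nat (a2 - int c * int q)) (\<lambda>i. e i q)"
  shows "row_recurrence b c a1 a2 e"
proof -
  have ipos: "int b > 0" "int c > 0" using pos by auto
  have outside: "e p q = 0"
    if q: "a2 \<le> int c * int q" and p: "int c * a1 * int q \<le> int b * a2 * int p" for p q
  proof -
    \<comment> \<open>Positivity of \<open>q\<close> and \<open>p\<close> rules out the two isolated
      points of the region.\<close>
    have "q > 0" using q pos by (cases q) auto
    then have "int c * a1 * int q > 0" using pos by simp
    then have "p > 0" using p by (cases p) auto
    then have "\<not> in_region b c a1 a2 p q"
      using half_planes_avoided[OF ipos pos(3,4) im q p] \<open>q > 0\<close>
      unfolding in_region_def by auto
    then show ?thesis using supp by blast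
  qed
  have inside: "e p q = 0"
    if q: "int c * int q < a2" and n: "int n = a2 - int c * int q" and "n \<le> p"
      and nz: "(p - n, q) \<noteq> (0, 0)" and p: "int c * a1 * int q \<le> int b * a2 * int (p - n)"
    for p q n
  proof -
    have "int (p - n) = int p - (a2 - int c * int q)"
      using \<open>n \<le> p\<close> n by simp
    \<comment> \<open>This denies the second inequality; as the row is low, the inclusion of
      half-planes denies the first as well.\<close>
    then have *: "int b * a2 * a2 \<le>
        int b * a2 * int p + (int b * int c * a2 - int c * a1) * int q"
      using p unfolding \<open>int (p - n) = _\<close> by (simp add: algebra_simps)
    then have "\<not> int c * a1 * int q + (int b * int c * a1 - int b * a2) * int p
        < int c * a1 * a1"
      using half_plane_inclusion[OF ipos pos(3,4) im, of "int q" "int p"] q by linarith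
    moreover have "p \<noteq> 0" using q n \<open>n \<le> p\<close> by auto
    moreover have "\<not> (int p = a2 \<and> q = 0)" using nz n by (cases "q = 0") auto
    ultimately have "\<not> in_region b c a1 a2 p q"
      using * unfolding in_region_def by auto
    then show ?thesis using supp by blast
  qed
  show ?thesis
    unfolding row_recurrence_iff[OF pos(1,4)]
  proof (intro allI conjI impI)
    fix q
    show "one_plus_t_power_dvd (nat (a2 - int c * int q)) (\<lambda>i. e i q)"
    proof (cases "int c * int q < a2")
      case False
      obtain d where
        d: "\<And>p. d \<le> p \<longleftrightarrow> (p, q) \<noteq> (0, 0) \<and> int c * a1 * int q \<le> int b * a2 * int p"
        using row_threshold[OF pos(1,4)] by metis
      \<comment> \<open>In a high row \<open>outside\<close> gives zeros from \<open>d\<close> on,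
        hence finiteness.\<close>
      have "one_plus_t_power_dvd 0 (\<lambda>i. e i q)"
        by (rule one_plus_t_power_dvd_0[of d]) (use outside d False in auto)
      then show ?thesis using False by simp
    qed (rule dvd)
  next
    fix p q
    assume "nat (a2 - int c * int q) \<le> p"
      and "(p - nat (a2 - int c * int q), q) \<noteq> (0, 0)"
      and "int c * a1 * int q \<le> int b * a2 * int (p - nat (a2 - int c * int q))"
    then show "e p q = 0"
      using inside[of q "nat (a2 - int c * int q)" p] outside[of q p]
      by (cases "int c * int q < a2") auto
  qed
qed

lemma axioms_imp_greedy_recurrence:
  assumes pos: "b > 0" "c > 0" "a1 > 0" "a2 > 0"
    and im: "int c * a1\<^sup>2 - int b * int c * a1 * a2 + int b * a2\<^sup>2 \<le> 0"
    and supp: "support_axiom b c a1 a2 e" and dvd: "divisibility_axiom b c a1 a2 e"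
  shows "greedy_recurrence b c a1 a2 e"
proof -
  have region: "in_region b c a1 a2 p q" if "e p q \<noteq> 0" for p q
    using supp that unfolding support_axiom_def R_greedy_iff[OF pos] by blast
  have im': "int b * a2\<^sup>2 - int c * int b * a2 * a1 + int c * a1\<^sup>2 \<le> 0"
    using im by (simp add: mult_ac)
  have "row_recurrence b c a1 a2 e"
    by (rule row_recurrence_of_axioms[OF pos im region])
      (use dvd in \<open>auto simp: divisibility_axiom_def\<close>)
  moreover have "row_recurrence c b a2 a1 (\<lambda>p q. e q p)"
    by (rule row_recurrence_of_axioms[OF pos(2,1,4,3) im'])
      (use dvd region in \<open>auto simp: divisibility_axiom_def in_region_swap\<close>)
  ultimately show ?thesis by (simp add: greedy_recurrence_iff_rows)
qed

section \<open>Uniqueness of the pointed coefficients\<close>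

text \<open>The sum in \<open>has_expansion\<close> before passage to fractions, with
  \<open>x1\<close> as inner and \<open>x2\<close> as outer variable, so that coefficients can be
  read off.\<close>

definition numerator_poly ::
    "nat \<Rightarrow> nat \<Rightarrow> (nat \<Rightarrow> nat \<Rightarrow> int) \<Rightarrow> rat poly poly" where
  "numerator_poly b c e =
     (\<Sum>(p, q) \<in> {(p, q). e p q \<noteq> 0}. monom (monom (of_int (e p q)) (b * p)) (c * q))"

lemma to_fract_power: "to_fract (x ^ n) = to_fract x ^ n"
  by (induction n) simp_all

lemma to_fract_of_int: "to_fract (of_int k) = of_int k"
proof -
  have "to_fract (of_nat n) = (of_nat n :: 'a fract)" for n
    by (induction n) simp_all
  then show ?thesis by (cases k) simp_all
qed

lemma to_fract_monom:
  "to_fract (monom (monom (of_int k) i) j) = of_int k * X1 ^ i * X2 ^ j"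
proof -
  have "monom (monom (of_int k) i) j =
      of_int k * [:[:0, 1:]:] ^ i * [:0, 1 :: rat poly:] ^ j"
    by (simp add: monom_altdef poly_const_pow of_int_poly mult.commute)
  then show ?thesis by (simp add: X1_def X2_def to_fract_power to_fract_of_int)
qed

lemma to_fract_numerator_poly:
  "to_fract (numerator_poly b c e) =
     (\<Sum>(p, q) \<in> {(p, q). e p q \<noteq> 0}. of_int (e p q) * X1 ^ (b * p) * X2 ^ (c * q))"
  unfolding numerator_poly_def
  by (simp add: to_fract_sum to_fract_monom case_prod_unfold)

text \<open>As \<open>b\<close> and \<open>c\<close> are positive, distinct pairs
  \<open>(p, q)\<close> give distinct monomials.\<close>

lemma coeff_numerator_poly:
  assumes "b > 0" "c > 0" "finite {(p, q). e p q \<noteq> 0}"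
  shows "coeff (coeff (numerator_poly b c e) (c * q)) (b * p) = of_int (e p q)"
proof -
  have "coeff (coeff (numerator_poly b c e) (c * q)) (b * p) =
      (\<Sum>z \<in> {(p, q). e p q \<noteq> 0}. if z = (p, q) then of_int (e p q) else 0)"
    unfolding numerator_poly_def coeff_sum
    by (rule sum.cong) (use assms(1,2) in \<open>auto split: if_splits\<close>)
  also have "\<dots> = of_int (e p q)"
    using assms(3) by simp
  finally show ?thesis .
qed

text \<open>The Laurent monomial in front is nonzero and cancels, and \<open>to_fract\<close> is
  injective.\<close>

lemma has_expansion_unique:
  assumes "b > 0" "c > 0" "has_expansion b c a1 a2 e x" "has_expansion b c a1 a2 e' x"
  shows "e = e'"
proof -
  have "X1 powi (- a1) * X2 powi (- a2) \<noteq> 0"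
    using pos_ratfun_nonzero[OF pos_ratfun_X1] pos_ratfun_nonzero[OF pos_ratfun_X2]
    by (simp add: power_int_not_zero)
  moreover have "X1 powi (- a1) * X2 powi (- a2) * to_fract (numerator_poly b c e) =
      X1 powi (- a1) * X2 powi (- a2) * to_fract (numerator_poly b c e')"
    using assms(3,4) unfolding has_expansion_def to_fract_numerator_poly
    by (elim conjE) (rule trans[OF sym])
  ultimately have "to_fract (numerator_poly b c e) = to_fract (numerator_poly b c e')"
    by (rule mult_left_cancel [THEN iffD1])
  then have "numerator_poly b c e = numerator_poly b c e'" by simp
  moreover have "finite {(p, q). e p q \<noteq> 0}" "finite {(p, q). e' p q \<noteq> 0}"
    using assms(3,4) by (auto simp: has_expansion_def)
  ultimately have "(of_int (e p q) :: rat) = of_int (e' p q)" for p q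
    using coeff_numerator_poly[OF assms(1,2), of e q p]
      coeff_numerator_poly[OF assms(1,2), of e' q p] by simp
  then show ?thesis by (simp add: fun_eq_iff)
qed

theorem theorem4:
  fixes b c :: nat and a1 a2 :: int and x :: ratfun2 and e :: "nat \<Rightarrow> nat \<Rightarrow> int"
  assumes "b > 0" and "c > 0"
    and "(a1, a2) \<in> pos_imaginary_roots b c"
    and "greedy_element b c a1 a2 x"
    and "has_expansion b c a1 a2 e x"
  shows "(e 0 0 = 1 \<and> support_axiom b c a1 a2 e \<and> divisibility_axiom b c a1 a2 e) \<and>
    (\<forall>e'. e' 0 0 = 1 \<and> support_axiom b c a1 a2 e' \<and> divisibility_axiom b c a1 a2 e' \<longrightarrow> e' = e)"
proof -
  have pos: "b > 0" "c > 0" "a1 > 0" "a2 > 0"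
    and im: "int c * a1\<^sup>2 - int b * int c * a1 * a2 + int b * a2\<^sup>2 \<le> 0"
    using assms(1-3) by (auto simp: pos_imaginary_roots_def)
  obtain e0 where "pointed_with b c a1 a2 e0 x" "greedy_recurrence b c a1 a2 e0"
    using assms(4) by (auto simp: greedy_element_def)
  \<comment> \<open>The greedy element brings its own coefficients \<open>e0\<close>; they are the
    given ones because expansions are unique.\<close>
  moreover from this have "e0 = e"
    using has_expansion_unique assms by (auto simp: pointed_with_def)
  ultimately have e: "e 0 0 = 1" "greedy_recurrence b c a1 a2 e"
    by (auto simp: pointed_with_def)
  \<comment> \<open>The axioms give the recurrence for \<open>e'\<close>, and the recurrence
    determines a family from its value at the origin.\<close>
  have "e' = e"
    if "e' 0 0 = 1" "support_axiom b c a1 a2 e'" "divisibility_axiom b c a1 a2 e'" for e'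
    using greedy_recurrence_unique[OF axioms_imp_greedy_recurrence[OF pos im that(2,3)] that(1)
        e(2,1)] by (simp add: fun_eq_iff)
  then show ?thesis
    using e greedy_recurrence_imp_support[OF pos e(2)]
      greedy_recurrence_imp_divisibility[OF pos e(2)] by blast
qed

end
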